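(* Let $\alpha,\beta$ be permutations with $|\alpha|>1$ and $|\beta|\ge1$, let $0\le i,j\le|\alpha|$, and let $\pi=\alpha\circledcirc_{i,j}\beta$. Then $$\mu[1,\pi]=-\sum_{\lambda\in\mathsf{R}_\pi}\mu[1,\lambda]+\sum_{c\in\mathcal{G}}(-1)^{|c|},$$ where $\mathsf{R}_\pi$ is the set of proper reductions of $\pi$ and $\mathcal{G}$ is the set of chains of $[1,\pi]$ defined in the context.
   Context: Permutations are ordered by classical pattern containment ($\sigma\le\pi$ if $\pi$ has a subsequence order-isomorphic to $\sigma$), and $\mu[\sigma,\pi]$ is the Möbius function of this poset: $\mu[\sigma,\sigma]=1$, $\mu[\sigma,\pi]=0$ if $\sigma\not\le\pi$, and $\mu[\sigma,\pi]=-\sum_{\sigma\le\lambda<\pi}\mu[\sigma,\lambda]$ if $\sigma<\pi$. Here $1$ is the permutation of length one and $\epsilon$ the empty permutation. Balloons. For permutations $\alpha$ and $\beta$ and $0\le i,j\le|\alpha|$, the balloon permutation $\alpha\circledcirc_{i,j}\beta$, of length $|\alpha|+|\beta|$, is obtained by inserting $\beta$ into $\alpha$ between the $i$-th and $(i+1)$-th columns and between the $j$-th and $(j+1)$-th rows: its $x$-th entry is $\alpha_x$ if $x\le i$ and $\alpha_x\le j$; $\alpha_x+|\beta|$ if $x\le i$ and $\alpha_x>j$; $\beta_{x-i}+j$ if $i<x\le i+|\beta|$; $\alpha_{x-|\beta|}$ if $x>i+|\beta|$ and $\alpha_{x-|\beta|}\le j$; $\alpha_{x-|\beta|}+|\beta|$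 if $x>i+|\beta|$ and $\alpha_{x-|\beta|}>j$. In particular $\alpha\circledcirc_{i,j}\epsilon=\alpha$. In $\pi=\alpha\circledcirc_{i,j}\beta$, colour blue the points in positions $i+1,\dots,i+|\beta|$ (the inserted copy of $\beta$) and red all other points (the copy of $\alpha$). An embedding of $\sigma$ into $\pi$ is a set of $|\sigma|$ points of $\pi$ order-isomorphic to $\sigma$. Fix $\pi=\alpha\circledcirc_{i,j}\beta$ and let $\sigma\le\pi$ be non-empty. - $\sigma$ is complete if $\sigma=\alpha\circledcirc_{i,j}\eta$ for some (possibly empty) permutation $\eta$. - $\sigma$ is a proper reduction of $\pi$ if $\sigma\ne\pi$ and every embedding of $\sigma$ into $\pi$ uses all the blue points. The set of proper reductions is $\mathsf{R}_\pi$. - Let $E_\sigma$ be the set of permutations (possibly including $\epsilon$) that arise as the pattern formed by the blue points used in some embedding of $\sigma$ into $\pi$. $\sigma$ is matryoshka if it is neither complete nor a proper reduction and there is $\zeta\in E_\sigma$ with $\zeta<\zeta'$ for every other $\zeta'\in E_\sigma$. Chains. A chain in $[1,\pi]$ is a totally ordered subset containing both $1$ and $\pi$; its length $|c|$ is its number of elements minus one. For a chain $c$, $\kappa_c$ is its second-highest element, and the pivot $\psi_c$ is the largest element of $c$ that is not complete (this exists since $|\alpha|>1$ implies $1$ is not complete). Let $\mathcal{C}$ be the set of all chains in $[1,\pi]$ and $\mathcal{R}=\{c\in\mathcal{C}:\kappa_c\text{ is a proper reduction}\}$, $\mathcal{M}=\{c\in\mathcal{C}\setminus\mathcal{R}:\psi_c\text{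 is matryoshka}\}$, $\mathcal{G}=\mathcal{C}\setminus(\mathcal{R}\cup\mathcal{M})$. *)

theory Defs
  imports Main
begin

section \<open>Permutations in one-line notation\<close>

text \<open>Positions and values are both counted from 1. The empty list is the empty permutation.\<close>

typedef permutation = "{xs :: nat list. distinct xs \<and> set xs = {1..length xs}}"
  morphisms one_line of_one_line
  by (rule exI[of _ "[]"]) simp

definition len :: "permutation \<Rightarrow> nat" where
  "len \<sigma> = length (one_line \<sigma>)"

definition entry :: "permutation \<Rightarrow> nat \<Rightarrow> nat" where
  "entry \<sigma> x = one_line \<sigma> ! (x - 1)"

definition empty_perm :: permutation where
  "empty_perm = of_one_line []"

definition one_perm :: permutation where
  "one_perm = of_one_line [1]"

lemma one_line_empty_perm: "one_line empty_perm = []"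
  unfolding empty_perm_def by (rule of_one_line_inverse) simp

lemma one_line_one_perm: "one_line one_perm = [1]"
  unfolding one_perm_def by (rule of_one_line_inverse) simp

lemma entry_bij: "bij_betw (entry \<sigma>) {1..len \<sigma>} {1..len \<sigma>}"
proof -
  have d: "distinct (one_line \<sigma>)" and s: "set (one_line \<sigma>) = {1..length (one_line \<sigma>)}"
    using one_line[of \<sigma>] by auto
  have 1: "bij_betw (\<lambda>x. x - 1) {1..len \<sigma>} {..<len \<sigma>}"
    by (rule bij_betw_byWitness[where f' = Suc]) auto
  have 2: "bij_betw ((!) (one_line \<sigma>)) {..<len \<sigma>} {1..len \<sigma>}"
    using bij_betw_nth[OF d refl refl] s by (simp add: len_def)
  have "entry \<sigma> = (!) (one_line \<sigma>) \<circ> (\<lambda>x. x - 1)"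
    by (auto simp: entry_def)
  then show ?thesis
    using bij_betw_trans[OF 1 2] by simp
qed

lemma permutation_eqI:
  assumes "len \<sigma> = len \<pi>" and "\<And>x. x \<in> {1..len \<sigma>} \<Longrightarrow> entry \<sigma> x = entry \<pi> x"
  shows "\<sigma> = \<pi>"
proof -
  have "one_line \<sigma> ! k = one_line \<pi> ! k" if "k < length (one_line \<sigma>)" for k
    using assms(2)[of "Suc k"] that by (simp add: entry_def len_def)
  then have "one_line \<sigma> = one_line \<pi>"
    using assms(1) by (simp add: list_eq_iff_nth_eq len_def)
  then show ?thesis by (simp add: one_line_inject)
qed


section \<open>Pattern containment\<close>

text \<open>A set of points of \<open>\<pi>\<close> is given by the set \<open>S\<close> of their positions.\<close>

definition embedding :: "nat set \<Rightarrow> permutation \<Rightarrow> permutation \<Rightarrow> bool" where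
  "embedding S \<sigma> \<pi> \<longleftrightarrow> S \<subseteq> {1..len \<pi>} \<and>
    (\<exists>f. strict_mono_on {1..len \<sigma>} f \<and> f ` {1..len \<sigma>} = S \<and>
      (\<forall>x\<in>{1..len \<sigma>}. \<forall>y\<in>{1..len \<sigma>}.
        entry \<sigma> x < entry \<sigma> y \<longleftrightarrow> entry \<pi> (f x) < entry \<pi> (f y)))"

instantiation permutation :: ord
begin

definition less_eq_permutation :: "permutation \<Rightarrow> permutation \<Rightarrow> bool" where
  "\<sigma> \<le> \<pi> \<longleftrightarrow> (\<exists>S. embedding S \<sigma> \<pi>)"

definition less_permutation :: "permutation \<Rightarrow> permutation \<Rightarrow> bool" where
  "\<sigma> < \<pi> \<longleftrightarrow> \<sigma> \<le> \<pi> \<and> \<sigma> \<noteq> \<pi>" for \<sigma> \<pi> :: permutation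

instance ..

end

lemma embedding_card: "embedding S \<sigma> \<pi> \<Longrightarrow> card S = len \<sigma>"
proof -
  assume "embedding S \<sigma> \<pi>"
  then obtain f where f: "strict_mono_on {1..len \<sigma>} f" "f ` {1..len \<sigma>} = S"
    unfolding embedding_def by blast
  have "card (f ` {1..len \<sigma>}) = card {1..len \<sigma>}"
    by (rule card_image[OF strict_mono_on_imp_inj_on[OF f(1)]])
  with f(2) show ?thesis by simp
qed

lemma permutation_le_len: "\<sigma> \<le> \<pi> \<Longrightarrow> len \<sigma> \<le> len \<pi>" for \<sigma> \<pi> :: permutation
proof -
  assume "\<sigma> \<le> \<pi>"
  then obtain S where S: "embedding S \<sigma> \<pi>" by (auto simp: less_eq_permutation_def)
  then have "card S \<le> card {1..len \<pi>}"
    by (intro card_mono) (auto simp: embedding_def)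
  with embedding_card[OF S] show ?thesis by simp
qed

lemma strict_mono_on_initial_id:
  fixes f :: "nat \<Rightarrow> nat"
  assumes "strict_mono_on {1..n} f" and "f ` {1..n} = {1..n}" and "x \<in> {1..n}"
  shows "f x = x"
proof -
  have lt: "f y < f z \<longleftrightarrow> y < z" if "y \<in> {1..n}" "z \<in> {1..n}" for y z
    using strict_mono_on_less[OF assms(1)] that by blast
  have "f x \<in> {1..n}" using assms(2,3) by blast
  have "f ` {y \<in> {1..n}. y < x} = {z \<in> {1..n}. z < f x}"
  proof (intro equalityI subsetI)
    fix z assume z: "z \<in> {z \<in> {1..n}. z < f x}"
    then obtain y where "y \<in> {1..n}" "z = f y" using assms(2) by blast
    then show "z \<in> f ` {y \<in> {1..n}. y < x}" using z lt assms(3) by blast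
  qed (use lt assms(2,3) in blast)
  moreover have "card (f ` {y \<in> {1..n}. y < x}) = card {y \<in> {1..n}. y < x}"
    by (rule card_image) (rule inj_on_subset[OF strict_mono_on_imp_inj_on[OF assms(1)]], auto)
  moreover have "{y \<in> {1..n}. y < x} = {1..<x}" using assms(3) by auto
  moreover have "{z \<in> {1..n}. z < f x} = {1..<f x}" using \<open>f x \<in> {1..n}\<close> by auto
  ultimately have "f x - 1 = x - 1" by simp
  then show ?thesis using assms(3) \<open>f x \<in> {1..n}\<close> by auto
qed

lemma entry_rank:
  assumes "x \<in> {1..len \<sigma>}"
  shows "card {y \<in> {1..len \<sigma>}. entry \<sigma> y < entry \<sigma> x} = entry \<sigma> x - 1"
proof -
  let ?A = "{y \<in> {1..len \<sigma>}. entry \<sigma> y < entry \<sigma> x}"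
  have inj: "inj_on (entry \<sigma>) {1..len \<sigma>}" and im: "entry \<sigma> ` {1..len \<sigma>} = {1..len \<sigma>}"
    using entry_bij[of \<sigma>] by (auto simp: bij_betw_def)
  have e: "entry \<sigma> x \<in> {1..len \<sigma>}" using im assms by blast
  have "entry \<sigma> ` ?A = {z \<in> entry \<sigma> ` {1..len \<sigma>}. z < entry \<sigma> x}" by blast
  also have "\<dots> = {1..<entry \<sigma> x}" unfolding im using e by auto
  finally have "entry \<sigma> ` ?A = {1..<entry \<sigma> x}" .
  moreover have "card (entry \<sigma> ` ?A) = card ?A"
    by (rule card_image) (rule inj_on_subset[OF inj], auto)
  ultimately show ?thesis by simp
qed

lemma permutation_le_len_eq:
  fixes \<sigma> \<pi> :: permutation
  assumes "\<sigma> \<le> \<pi>" and "len \<sigma> = len \<pi>"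
  shows "\<sigma> = \<pi>"
proof -
  obtain S where S: "embedding S \<sigma> \<pi>" using assms(1) by (auto simp: less_eq_permutation_def)
  have "S = {1..len \<pi>}"
    using embedding_card[OF S] S assms(2) by (intro card_subset_eq) (auto simp: embedding_def)
  with S obtain f where f: "strict_mono_on {1..len \<sigma>} f" "f ` {1..len \<sigma>} = {1..len \<sigma>}"
    and ord: "\<forall>x\<in>{1..len \<sigma>}. \<forall>y\<in>{1..len \<sigma>}.
        entry \<sigma> x < entry \<sigma> y \<longleftrightarrow> entry \<pi> (f x) < entry \<pi> (f y)"
    unfolding embedding_def assms(2) by blast
  have ord': "entry \<sigma> x < entry \<sigma> y \<longleftrightarrow> entry \<pi> x < entry \<pi> y"
    if "x \<in> {1..len \<sigma>}" "y \<in> {1..len \<sigma>}" for x y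
    using ord that strict_mono_on_initial_id[OF f] by simp
  show ?thesis
  proof (rule permutation_eqI[OF assms(2)])
    fix x assume x: "x \<in> {1..len \<sigma>}"
    have "{y \<in> {1..len \<sigma>}. entry \<sigma> y < entry \<sigma> x} = {y \<in> {1..len \<pi>}. entry \<pi> y < entry \<pi> x}"
      using ord' x assms(2) by auto
    then have "entry \<sigma> x - 1 = entry \<pi> x - 1"
      using entry_rank[of x \<sigma>] entry_rank[of x \<pi>] x assms(2) by simp
    moreover have "entry \<sigma> x \<ge> 1" "entry \<pi> x \<ge> 1"
      using bij_betwE[OF entry_bij[of \<sigma>]] bij_betwE[OF entry_bij[of \<pi>]] x assms(2) by auto
    ultimately show "entry \<sigma> x = entry \<pi> x" by simp
  qed
qed

instance permutation :: order
proof
  fix \<sigma> \<pi> \<tau> :: permutation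
  show "\<sigma> \<le> \<sigma>"
    unfolding less_eq_permutation_def embedding_def
    by (rule exI[of _ "{1..len \<sigma>}"]) (auto intro!: exI[of _ id] simp: strict_mono_on_def)
  show antisym: "\<sigma> = \<pi>" if "\<sigma> \<le> \<pi>" "\<pi> \<le> \<sigma>"
    by (rule permutation_le_len_eq[OF that(1)])
      (rule le_antisym[OF permutation_le_len[OF that(1)] permutation_le_len[OF that(2)]])
  show "\<sigma> < \<pi> \<longleftrightarrow> \<sigma> \<le> \<pi> \<and> \<not> \<pi> \<le> \<sigma>"
    unfolding less_permutation_def using antisym \<open>\<sigma> \<le> \<sigma>\<close> by blast
  show "\<sigma> \<le> \<tau>" if "\<sigma> \<le> \<pi>" "\<pi> \<le> \<tau>"
  proof -
    from that(1) obtain f where f: "f ` {1..len \<sigma>} \<subseteq> {1..len \<pi>}" "strict_mono_on {1..len \<sigma>} f"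
      "\<forall>x\<in>{1..len \<sigma>}. \<forall>y\<in>{1..len \<sigma>}.
        entry \<sigma> x < entry \<sigma> y \<longleftrightarrow> entry \<pi> (f x) < entry \<pi> (f y)"
      unfolding less_eq_permutation_def embedding_def by blast
    from that(2) obtain g where g: "g ` {1..len \<pi>} \<subseteq> {1..len \<tau>}" "strict_mono_on {1..len \<pi>} g"
      "\<forall>x\<in>{1..len \<pi>}. \<forall>y\<in>{1..len \<pi>}.
        entry \<pi> x < entry \<pi> y \<longleftrightarrow> entry \<tau> (g x) < entry \<tau> (g y)"
      unfolding less_eq_permutation_def embedding_def by blast
    have fin: "f x \<in> {1..len \<pi>}" if "x \<in> {1..len \<sigma>}" for x
      using f(1) that by blast
    have "embedding ((g \<circ> f) ` {1..len \<sigma>}) \<sigma> \<tau>"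
      unfolding embedding_def
    proof (intro conjI exI[of _ "g \<circ> f"])
      show "(g \<circ> f) ` {1..len \<sigma>} \<subseteq> {1..len \<tau>}"
        unfolding image_comp[symmetric] using image_mono[OF f(1), of g] g(1) by (rule subset_trans)
      show "strict_mono_on {1..len \<sigma>} (g \<circ> f)"
        using f(2) g(2) fin unfolding strict_mono_on_def comp_def by blast
      show "\<forall>x\<in>{1..len \<sigma>}. \<forall>y\<in>{1..len \<sigma>}. entry \<sigma> x < entry \<sigma> y \<longleftrightarrow>
          entry \<tau> ((g \<circ> f) x) < entry \<tau> ((g \<circ> f) y)"
        using f(3) g(3) fin unfolding comp_def by blast
    qed simp
    then show ?thesis unfolding less_eq_permutation_def by blast
  qed
qed

lemma permutation_less_len: "\<sigma> < \<pi> \<Longrightarrow> len \<sigma> < len \<pi>" for \<sigma> \<pi> :: permutation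
  unfolding less_permutation_def
  using permutation_le_len[of \<sigma> \<pi>] permutation_le_len_eq[of \<sigma> \<pi>] nat_less_le by blast

lemma finite_atMost_permutation: "finite {..\<pi>}" for \<pi> :: permutation
proof -
  have "one_line ` {..\<pi>} \<subseteq> {xs. set xs \<subseteq> {1..len \<pi>} \<and> length xs \<le> len \<pi>}"
  proof
    fix xs assume "xs \<in> one_line ` {..\<pi>}"
    then obtain \<sigma> where "xs = one_line \<sigma>" "\<sigma> \<le> \<pi>" by auto
    then show "xs \<in> {xs. set xs \<subseteq> {1..len \<pi>} \<and> length xs \<le> len \<pi>}"
      using one_line[of \<sigma>] permutation_le_len[of \<sigma> \<pi>] by (auto simp: len_def)
  qed
  moreover have "finite {xs. set xs \<subseteq> {1..len \<pi>} \<and> length xs \<le> len \<pi>}"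
    by (rule finite_lists_length_le) simp
  ultimately have "finite (one_line ` {..\<pi>})" by (rule finite_subset)
  then show ?thesis
    by (rule finite_imageD) (auto simp: inj_on_def one_line_inject)
qed


section \<open>The Moebius function\<close>

function mobius :: "permutation \<Rightarrow> permutation \<Rightarrow> int" where
  "mobius \<sigma> \<pi> =
    (if \<sigma> = \<pi> then 1
     else if \<sigma> < \<pi> then - (\<Sum>\<tau>\<in>{\<sigma>..<\<pi>}. mobius \<sigma> \<tau>)
     else 0)"
  by pat_completeness auto
termination
  by (relation "measure (\<lambda>(\<sigma>, \<pi>). len \<pi>)") (auto intro: permutation_less_len)

declare mobius.simps [simp del]


section \<open>Balloon permutations\<close>

definition balloon_entry ::
  "permutation \<Rightarrow> nat \<Rightarrow> nat \<Rightarrow> permutation \<Rightarrow> nat \<Rightarrow> nat" where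
  "balloon_entry \<alpha> i j \<beta> x =
    (if x \<le> i then
       (if entry \<alpha> x \<le> j then entry \<alpha> x else entry \<alpha> x + len \<beta>)
     else if x \<le> i + len \<beta> then entry \<beta> (x - i) + j
     else
       (if entry \<alpha> (x - len \<beta>) \<le> j then entry \<alpha> (x - len \<beta>)
        else entry \<alpha> (x - len \<beta>) + len \<beta>))"

text \<open>Only meaningful for \<open>i \<le> len \<alpha>\<close> and \<open>j \<le> len \<alpha>\<close>, where the list is a permutation
  (\<open>one_line_balloon\<close> below).\<close>

definition balloon :: "permutation \<Rightarrow> nat \<Rightarrow> nat \<Rightarrow> permutation \<Rightarrow> permutation" where
  "balloon \<alpha> i j \<beta> =
    of_one_line (map (balloon_entry \<alpha> i j \<beta>) [1..<Suc (len \<alpha> + len \<beta>)])"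

lemma one_line_balloon:
  assumes "i \<le> len \<alpha>" and "j \<le> len \<alpha>"
  shows "one_line (balloon \<alpha> i j \<beta>) =
    map (balloon_entry \<alpha> i j \<beta>) [1..<Suc (len \<alpha> + len \<beta>)]"
proof -
  let ?n = "len \<alpha> + len \<beta>"
  let ?b = "balloon_entry \<alpha> i j \<beta>"
  have a: "entry \<alpha> x \<in> {1..len \<alpha>}" if "x \<in> {1..len \<alpha>}" for x
    using bij_betwE[OF entry_bij[of \<alpha>]] that by blast
  have b: "entry \<beta> x \<in> {1..len \<beta>}" if "x \<in> {1..len \<beta>}" for x
    using bij_betwE[OF entry_bij[of \<beta>]] that by blast
  have injA: "x = y" if "entry \<alpha> x = entry \<alpha> y" "x \<in> {1..len \<alpha>}" "y \<in> {1..len \<alpha>}" for x y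
    using inj_onD[OF bij_betw_imp_inj_on[OF entry_bij[of \<alpha>]]] that by blast
  have injB: "x = y" if "entry \<beta> x = entry \<beta> y" "x \<in> {1..len \<beta>}" "y \<in> {1..len \<beta>}" for x y
    using inj_onD[OF bij_betw_imp_inj_on[OF entry_bij[of \<beta>]]] that by blast
  define red where "red x = (if x \<le> i then x else x - len \<beta>)" for x
  define shift where "shift v = (if v \<le> j then v else v + len \<beta>)" for v
  define blue where "blue x \<longleftrightarrow> i < x \<and> x \<le> i + len \<beta>" for x
  have eq: "?b x = (if blue x then entry \<beta> (x - i) + j else shift (entry \<alpha> (red x)))" for x
    by (auto simp: balloon_entry_def red_def shift_def blue_def)
  have redin: "red x \<in> {1..len \<alpha>}" if "x \<in> {1..?n}" "\<not> blue x" for x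
    using that assms(1) by (auto simp: red_def blue_def)
  have bluein: "x - i \<in> {1..len \<beta>}" if "blue x" for x
    using that by (auto simp: blue_def)
  have ran: "?b x \<in> {1..?n}" if "x \<in> {1..?n}" for x
    using a[OF redin[OF that]] b[OF bluein, of x] assms(2) by (auto simp: eq shift_def)
  have disj: "entry \<beta> (x - i) + j \<noteq> shift v" if "blue x" for x v
    using b[OF bluein[OF that]] by (auto simp: shift_def)
  have shift_inj: "v = w" if "shift v = shift w" for v w
    using that by (auto simp: shift_def split: if_splits)
  have red_inj: "x = y" if "red x = red y" "\<not> blue x" "\<not> blue y" for x y
    using that by (auto simp: red_def blue_def split: if_splits)
  have inj: "inj_on ?b {1..?n}"
  proof (rule inj_onI)
    fix x y assume xy: "x \<in> {1..?n}" "y \<in> {1..?n}" and e: "?b x = ?b y"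
    show "x = y"
    proof (cases "blue x")
      case True
      then have yb: "blue y" using e disj by (auto simp: eq split: if_splits)
      have "entry \<beta> (x - i) = entry \<beta> (y - i)"
        using e True yb by (simp add: eq)
      then have "x - i = y - i"
        using injB bluein True yb by blast
      then show ?thesis using True yb by (auto simp: blue_def)
    next
      case False
      then have yb: "\<not> blue y" using e False disj[of y "entry \<alpha> (red x)"] by (auto simp: eq split: if_splits)
      then have "shift (entry \<alpha> (red x)) = shift (entry \<alpha> (red y))"
        using e False by (simp add: eq)
      then have "entry \<alpha> (red x) = entry \<alpha> (red y)"
        by (rule shift_inj)
      then have "red x = red y"
        using injA redin xy False yb by blast
      then show ?thesis using red_inj False yb by blast
    qed
  qed
  have set: "set [1..<Suc ?n] = {1..?n}" by auto
  have "?b ` {1..?n} = {1..?n}"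
    by (rule endo_inj_surj[OF _ _ inj]) (use ran in auto)
  then show ?thesis
    unfolding balloon_def
    using inj by (intro of_one_line_inverse)
      (simp add: distinct_map set atLeastLessThanSuc_atLeastAtMost del: upt_Suc)
qed

text \<open>In what follows a balloon permutation \<open>\<pi> = balloon \<alpha> i j \<beta>\<close> is always given by
  \<open>\<alpha>, i, j, \<beta>\<close>, since the colouring and the notions built on it depend on these data and not
  just on \<open>\<pi>\<close>.\<close>

definition blue_points :: "nat \<Rightarrow> permutation \<Rightarrow> nat set" where
  "blue_points i \<beta> = {i + 1..i + len \<beta>}"

definition complete_perm :: "permutation \<Rightarrow> nat \<Rightarrow> nat \<Rightarrow> permutation \<Rightarrow> bool" where
  "complete_perm \<alpha> i j \<sigma> \<longleftrightarrow> (\<exists>\<eta>. \<sigma> = balloon \<alpha> i j \<eta>)"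

definition proper_reductions ::
  "permutation \<Rightarrow> nat \<Rightarrow> nat \<Rightarrow> permutation \<Rightarrow> permutation set" where
  "proper_reductions \<alpha> i j \<beta> =
    {\<sigma>. \<sigma> \<noteq> empty_perm \<and> \<sigma> \<le> balloon \<alpha> i j \<beta> \<and> \<sigma> \<noteq> balloon \<alpha> i j \<beta> \<and>
      (\<forall>S. embedding S \<sigma> (balloon \<alpha> i j \<beta>) \<longrightarrow> blue_points i \<beta> \<subseteq> S)}"

text \<open>The set \<open>E\<^sub>\<sigma>\<close>: the blue part of an embedding has pattern \<open>\<zeta>\<close> iff it is itself an
  embedding of \<open>\<zeta>\<close>.\<close>

definition blue_patterns ::
  "permutation \<Rightarrow> nat \<Rightarrow> nat \<Rightarrow> permutation \<Rightarrow> permutation \<Rightarrow> permutation set" where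
  "blue_patterns \<alpha> i j \<beta> \<sigma> =
    {\<zeta>. \<exists>S. embedding S \<sigma> (balloon \<alpha> i j \<beta>) \<and>
      embedding (S \<inter> blue_points i \<beta>) \<zeta> (balloon \<alpha> i j \<beta>)}"

definition matryoshka ::
  "permutation \<Rightarrow> nat \<Rightarrow> nat \<Rightarrow> permutation \<Rightarrow> permutation \<Rightarrow> bool" where
  "matryoshka \<alpha> i j \<beta> \<sigma> \<longleftrightarrow>
    \<sigma> \<noteq> empty_perm \<and> \<sigma> \<le> balloon \<alpha> i j \<beta> \<and>
    \<not> complete_perm \<alpha> i j \<sigma> \<and> \<sigma> \<notin> proper_reductions \<alpha> i j \<beta> \<and>
    (\<exists>\<zeta>\<in>blue_patterns \<alpha> i j \<beta> \<sigma>. \<forall>\<zeta>'\<in>blue_patterns \<alpha> i j \<beta> \<sigma>. \<zeta>' \<noteq> \<zeta> \<longrightarrow> \<zeta> < \<zeta>')"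


section \<open>Chains\<close>

definition chains_from_one :: "permutation \<Rightarrow> permutation set set" where
  "chains_from_one \<pi> =
    {c. c \<subseteq> {one_perm..\<pi>} \<and> Complete_Partial_Order.chain (\<le>) c \<and> one_perm \<in> c \<and> \<pi> \<in> c}"

definition chain_length :: "permutation set \<Rightarrow> nat" where
  "chain_length c = card c - 1"

definition second_highest :: "permutation set \<Rightarrow> permutation" where
  "second_highest c = (GREATEST \<kappa>. \<kappa> \<in> c \<and> \<kappa> \<noteq> (GREATEST \<tau>. \<tau> \<in> c))"

definition pivot :: "permutation \<Rightarrow> nat \<Rightarrow> nat \<Rightarrow> permutation set \<Rightarrow> permutation" where
  "pivot \<alpha> i j c = (GREATEST \<psi>. \<psi> \<in> c \<and> \<not> complete_perm \<alpha> i j \<psi>)"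

definition R_chains ::
  "permutation \<Rightarrow> nat \<Rightarrow> nat \<Rightarrow> permutation \<Rightarrow> permutation set set" where
  "R_chains \<alpha> i j \<beta> =
    {c \<in> chains_from_one (balloon \<alpha> i j \<beta>). second_highest c \<in> proper_reductions \<alpha> i j \<beta>}"

definition M_chains ::
  "permutation \<Rightarrow> nat \<Rightarrow> nat \<Rightarrow> permutation \<Rightarrow> permutation set set" where
  "M_chains \<alpha> i j \<beta> =
    {c \<in> chains_from_one (balloon \<alpha> i j \<beta>) - R_chains \<alpha> i j \<beta>.
      matryoshka \<alpha> i j \<beta> (pivot \<alpha> i j c)}"

definition G_chains ::
  "permutation \<Rightarrow> nat \<Rightarrow> nat \<Rightarrow> permutation \<Rightarrow> permutation set set" where
  "G_chains \<alpha> i j \<beta> =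
    chains_from_one (balloon \<alpha> i j \<beta>) - (R_chains \<alpha> i j \<beta> \<union> M_chains \<alpha> i j \<beta>)"

end

theory Submission
  imports Defs "HOL-Library.Infinite_Set"
begin

text \<open>By Philip Hall's theorem, \<open>mobius one_perm \<pi>\<close> is the sum of \<open>(-1) ^ |c|\<close> over all chains
  \<open>c\<close> from \<open>one_perm\<close> to \<open>\<pi>\<close> (\<open>mobius_eq_signed_chain_sum\<close>). The three classes of chains then
  contribute as follows.

  Deleting the top of a chain whose second-highest element is \<open>\<rho>\<close> leaves an arbitrary chain from
  \<open>one_perm\<close> to \<open>\<rho>\<close> of length one less. So the chains with \<open>\<rho>\<close> a proper reduction contribute
  \<open>- mobius one_perm \<rho>\<close> for each \<open>\<rho>\<close> (\<open>signed_chain_sum_second_highest\<close>); Hall's theorem is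
  itself the case where \<open>\<rho>\<close> is unrestricted.

  The chains with a matryoshka pivot cancel in pairs (\<open>signed_chain_sum_M_chains\<close>). The reason is
  that among the complete permutations between a matryoshka \<open>\<psi>\<close> and \<open>\<pi>\<close> there is a least one
  (\<open>matryoshka_least_complete_above\<close>), namely the balloon around the least blue pattern of \<open>\<psi>\<close>.
  In a chain with pivot \<open>\<psi>\<close> everything above \<open>\<psi>\<close> is complete, so this least element is
  comparable to the whole chain, and inserting or deleting it pairs off the chains with pivot \<open>\<psi>\<close>.
  The chains in neither class are those in \<open>G_chains\<close>, whose sum is left as it is.

  That the least blue pattern gives the least balloon rests on a cancellation law: a balloon around
  \<open>\<eta>\<close> lies below the balloon around \<open>\<beta>\<close> only if \<open>\<eta> \<le> \<beta>\<close> (\<open>balloon_le_cancel\<close>). An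
  embedding is increasing in positions, so a blue point cannot be sent to a red one: it has at least
  \<open>i\<close> points to its left and \<open>len \<alpha> - i\<close> to its right, as does its image.\<close>

section \<open>Order isomorphisms between point sets\<close>

text \<open>The domain is an arbitrary set \<open>A\<close> of positions, rather than all of \<open>\<sigma>\<close>, so that these maps can be
  restricted and inverted.\<close>

definition pattern_map ::
  "nat set \<Rightarrow> (nat \<Rightarrow> nat) \<Rightarrow> permutation \<Rightarrow> permutation \<Rightarrow> bool" where
  "pattern_map A f \<sigma> \<pi> \<longleftrightarrow> strict_mono_on A f \<and>
    (\<forall>x\<in>A. \<forall>y\<in>A. entry \<sigma> x < entry \<sigma> y \<longleftrightarrow> entry \<pi> (f x) < entry \<pi> (f y))"

lemma embedding_iff_pattern_map:
  "embedding S \<sigma> \<pi> \<longleftrightarrow>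
    S \<subseteq> {1..len \<pi>} \<and> (\<exists>f. pattern_map {1..len \<sigma>} f \<sigma> \<pi> \<and> f ` {1..len \<sigma>} = S)"
  unfolding embedding_def pattern_map_def by blast

lemma pattern_map_inj_on: "pattern_map A f \<sigma> \<pi> \<Longrightarrow> inj_on f A"
  unfolding pattern_map_def by (blast intro: strict_mono_on_imp_inj_on)

lemma pattern_map_subset: "pattern_map A f \<sigma> \<pi> \<Longrightarrow> B \<subseteq> A \<Longrightarrow> pattern_map B f \<sigma> \<pi>"
  unfolding pattern_map_def by (auto intro: monotone_on_subset)

lemma pattern_map_comp:
  assumes "pattern_map A f \<sigma> \<pi>" and "pattern_map (f ` A) g \<pi> \<tau>"
  shows "pattern_map A (g \<circ> f) \<sigma> \<tau>"
  using assms unfolding pattern_map_def monotone_on_def by simp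

lemma pattern_map_inv_into:
  assumes f: "pattern_map A f \<sigma> \<pi>"
  shows "pattern_map (f ` A) (inv_into A f) \<pi> \<sigma>"
proof -
  have inv: "inv_into A f (f x) = x" if "x \<in> A" for x
    using pattern_map_inj_on[OF f] that by simp
  have "f x < f y \<longleftrightarrow> x < y" if "x \<in> A" "y \<in> A" for x y
    using f that strict_mono_on_less unfolding pattern_map_def by blast
  then show ?thesis
    using f inv unfolding pattern_map_def monotone_on_def by simp
qed

lemma embedding_transport:
  assumes "embedding S \<sigma> \<pi>" and "pattern_map S g \<pi> \<tau>" and "g ` S \<subseteq> {1..len \<tau>}"
  shows "embedding (g ` S) \<sigma> \<tau>"
proof -
  obtain f where f: "pattern_map {1..len \<sigma>} f \<sigma> \<pi>" "f ` {1..len \<sigma>} = S"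
    using assms(1) unfolding embedding_iff_pattern_map by blast
  have "pattern_map {1..len \<sigma>} (g \<circ> f) \<sigma> \<tau>" "(g \<circ> f) ` {1..len \<sigma>} = g ` S"
    using pattern_map_comp[OF f(1)] f(2) assms(2) by auto
  then show ?thesis
    unfolding embedding_iff_pattern_map using assms(3) by blast
qed

text \<open>The inverse of the map that embeds \<open>\<tau>\<close> carries the smaller point set into \<open>\<tau>\<close>.\<close>

lemma le_if_embedding_subset:
  assumes S: "embedding S \<sigma> \<pi>" and T: "embedding T \<tau> \<pi>" and "S \<subseteq> T"
  shows "\<sigma> \<le> \<tau>"
proof -
  obtain f where f: "pattern_map {1..len \<tau>} f \<tau> \<pi>" "f ` {1..len \<tau>} = T"
    using T unfolding embedding_iff_pattern_map by blast
  let ?g = "inv_into {1..len \<tau>} f"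
  have "pattern_map T ?g \<pi> \<tau>"
    using pattern_map_inv_into[OF f(1)] f(2) by simp
  moreover have "?g ` S \<subseteq> {1..len \<tau>}"
    using inv_into_into[of _ f "{1..len \<tau>}"] f(2) \<open>S \<subseteq> T\<close> by blast
  ultimately have "embedding (?g ` S) \<sigma> \<tau>"
    using embedding_transport[OF S] pattern_map_subset[OF _ \<open>S \<subseteq> T\<close>] by metis
  then show ?thesis unfolding less_eq_permutation_def by blast
qed

lemma embedding_within_embedding:
  assumes T: "embedding T \<tau> \<pi>" and "\<sigma> \<le> \<tau>"
  obtains S where "S \<subseteq> T" and "embedding S \<sigma> \<pi>"
proof -
  obtain f where f: "pattern_map {1..len \<tau>} f \<tau> \<pi>" "f ` {1..len \<tau>} = T" and T': "T \<subseteq> {1..len \<pi>}"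
    using T unfolding embedding_iff_pattern_map by blast
  obtain S where S: "embedding S \<sigma> \<tau>"
    using \<open>\<sigma> \<le> \<tau>\<close> unfolding less_eq_permutation_def by blast
  have sub: "S \<subseteq> {1..len \<tau>}" using S unfolding embedding_def by blast
  have "embedding (f ` S) \<sigma> \<pi>"
    by (rule embedding_transport[OF S pattern_map_subset[OF f(1) sub]]) (use f(2) sub T' in blast)
  then show ?thesis by (rule that[rotated]) (use f(2) sub in blast)
qed

lemma embedding_full: "embedding {1..len \<pi>} \<pi> \<pi>"
  unfolding embedding_def by (auto intro!: exI[of _ id] simp: strict_mono_on_def)

text \<open>Standardization: replacing each value by its rank turns any injective sequence into a
  permutation with the same relative order.\<close>

lemma standardization_exists:
  fixes h :: "nat \<Rightarrow> nat"
  assumes inj: "inj_on h {1..n}"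
  obtains \<sigma> where "len \<sigma> = n"
    and "\<And>x y. x \<in> {1..n} \<Longrightarrow> y \<in> {1..n} \<Longrightarrow> entry \<sigma> x < entry \<sigma> y \<longleftrightarrow> h x < h y"
proof -
  define r where "r x = card {y \<in> {1..n}. h y \<le> h x}" for x
  have less: "r x < r y" if "h x < h y" "y \<in> {1..n}" for x y
  proof -
    have "y \<in> {z \<in> {1..n}. h z \<le> h y}" "y \<notin> {z \<in> {1..n}. h z \<le> h x}" using that by auto
    then have "{z \<in> {1..n}. h z \<le> h x} \<subset> {z \<in> {1..n}. h z \<le> h y}" using that(1) by fastforce
    then show ?thesis unfolding r_def by (intro psubset_card_mono) auto
  qed
  have le: "r x \<le> r y" if "h x \<le> h y" for x y
    unfolding r_def using that by (intro card_mono) auto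
  have less_iff: "r x < r y \<longleftrightarrow> h x < h y" if "x \<in> {1..n}" "y \<in> {1..n}" for x y
    using less le that by (meson not_less)
  have r_inj: "inj_on r {1..n}"
    using inj less unfolding inj_on_def by (metis less_irrefl linorder_neqE_nat)
  have range: "r x \<in> {1..n}" if "x \<in> {1..n}" for x
  proof -
    have "r x \<le> card {1..n}" unfolding r_def by (intro card_mono) auto
    moreover have "r x \<noteq> 0" unfolding r_def using that by auto
    ultimately show ?thesis by simp
  qed
  have "r ` {1..n} = {1..n}"
    by (rule endo_inj_surj[OF _ _ r_inj]) (use range in auto)
  then have ol: "one_line (of_one_line (map r [1..<Suc n])) = map r [1..<Suc n]"
    using r_inj by (intro of_one_line_inverse)
      (simp add: distinct_map atLeastLessThanSuc_atLeastAtMost del: upt_Suc)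
  show ?thesis
  proof (rule that)
    let ?\<sigma> = "of_one_line (map r [1..<Suc n])"
    show "len ?\<sigma> = n" unfolding len_def ol by simp
    have "entry ?\<sigma> x = r x" if "x \<in> {1..n}" for x
      using that unfolding entry_def ol by (subst nth_map) (auto simp del: upt_Suc)
    then show "entry ?\<sigma> x < entry ?\<sigma> y \<longleftrightarrow> h x < h y" if "x \<in> {1..n}" "y \<in> {1..n}" for x y
      using less_iff that by simp
  qed
qed

text \<open>This is what lets the blue part of a given embedding be named by a permutation, and hence be
  compared with the least blue pattern.\<close>

lemma pattern_exists:
  assumes T: "T \<subseteq> {1..len \<pi>}"
  obtains \<sigma> where "embedding T \<sigma> \<pi>"
proof -
  have "finite T" using T finite_subset by blast
  then obtain f where f: "bij_betw f {..<card T} T" "strict_mono_on {..<card T} f"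
    by (rule ex_bij_betw_strict_mono_card)
  define g where "g x = f (x - 1)" for x
  have g: "strict_mono_on {1..card T} g"
    using f(2) unfolding g_def monotone_on_def by auto
  have "(\<lambda>x. x - 1) ` {1..card T} = {..<card T}"
  proof (intro equalityI subsetI)
    fix y assume "y \<in> {..<card T}"
    then show "y \<in> (\<lambda>x. x - 1) ` {1..card T}" by (intro image_eqI[of _ _ "Suc y"]) auto
  qed auto
  then have im: "g ` {1..card T} = T"
    using f(1) unfolding g_def bij_betw_def by (metis image_image)
  have "inj_on (entry \<pi>) T"
    using entry_bij[of \<pi>] T unfolding bij_betw_def by (blast intro: inj_on_subset)
  then have "inj_on (entry \<pi> \<circ> g) {1..card T}"
    using strict_mono_on_imp_inj_on[OF g] im by (auto intro: comp_inj_on)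
  then obtain \<sigma> where "len \<sigma> = card T" and
    "\<And>x y. x \<in> {1..card T} \<Longrightarrow> y \<in> {1..card T} \<Longrightarrow>
      entry \<sigma> x < entry \<sigma> y \<longleftrightarrow> (entry \<pi> \<circ> g) x < (entry \<pi> \<circ> g) y"
    by (rule standardization_exists) blast
  then have "embedding T \<sigma> \<pi>"
    unfolding embedding_def using T g im by (auto intro!: exI[of _ g])
  then show ?thesis by (rule that)
qed

lemma len_one_perm: "len one_perm = 1"
  unfolding len_def one_line_one_perm by simp

lemma one_perm_le:
  assumes "\<sigma> \<noteq> empty_perm"
  shows "one_perm \<le> \<sigma>"
proof -
  have "len \<sigma> \<noteq> 0"
    using permutation_eqI[of \<sigma> empty_perm] assms by (auto simp: len_def one_line_empty_perm)
  then have "embedding {1} one_perm \<sigma>"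
    unfolding embedding_def len_one_perm by (auto intro!: exI[of _ id] simp: strict_mono_on_def)
  then show ?thesis unfolding less_eq_permutation_def by blast
qed

lemma entry_range: "x \<in> {1..len \<beta>} \<Longrightarrow> entry \<beta> x \<in> {1..len \<beta>}"
  using bij_betwE[OF entry_bij[of \<beta>]] by blast

text \<open>Counting: \<open>f\<close> sends the \<open>x\<close> positions up to \<open>x\<close> to distinct positions up to \<open>f x\<close>, and
  likewise to the right. These two bounds confine the images of blue points in
  \<open>balloon_le_cancel\<close>.\<close>

lemma strict_mono_on_bounds:
  fixes f :: "nat \<Rightarrow> nat"
  assumes mono: "strict_mono_on {1..k} f" and ran: "f ` {1..k} \<subseteq> {1..l}" and x: "x \<in> {1..k}"
  shows "x \<le> f x" and "f x + (k - x) \<le> l"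
proof -
  have inj: "inj_on f {1..k}" by (rule strict_mono_on_imp_inj_on[OF mono])
  have le: "f y \<le> f z" if "y \<in> {1..k}" "z \<in> {1..k}" "y \<le> z" for y z
    using strict_mono_on_leD[OF mono] that by blast
  have "f ` {1..x} \<subseteq> {1..f x}" using ran le x by (auto simp: image_subset_iff)
  then have "card (f ` {1..x}) \<le> card {1..f x}" by (rule card_mono[rotated]) simp
  moreover have "card (f ` {1..x}) = card {1..x}"
    using x by (intro card_image inj_on_subset[OF inj]) auto
  ultimately show "x \<le> f x" by simp
  have "f ` {x..k} \<subseteq> {f x..l}" using ran le x by (auto simp: image_subset_iff)
  then have "card (f ` {x..k}) \<le> card {f x..l}" by (rule card_mono[rotated]) simp
  moreover have "card (f ` {x..k}) = card {x..k}"
    using x by (intro card_image inj_on_subset[OF inj]) auto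
  ultimately have "Suc k - x \<le> Suc l - f x" by simp
  moreover have "f x \<le> l" using ran imageI[OF x, of f] by auto
  ultimately show "f x + (k - x) \<le> l" using x by auto
qed


section \<open>Balloons over a fixed permutation\<close>

context
  fixes \<alpha> :: permutation and i j :: nat
  assumes i: "i \<le> len \<alpha>" and j: "j \<le> len \<alpha>"
begin

lemma len_balloon: "len (balloon \<alpha> i j \<beta>) = len \<alpha> + len \<beta>"
  using one_line_balloon[OF i j] by (simp add: len_def[of "balloon \<alpha> i j \<beta>"] del: upt_Suc)

lemma entry_balloon:
  "x \<in> {1..len \<alpha> + len \<beta>} \<Longrightarrow> entry (balloon \<alpha> i j \<beta>) x = balloon_entry \<alpha> i j \<beta> x"
  unfolding entry_def one_line_balloon[OF i j] by (subst nth_map) (auto simp del: upt_Suc)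

lemma entry_balloon_left:
  "x \<in> {1..i} \<Longrightarrow> entry (balloon \<alpha> i j \<beta>) x =
    (if entry \<alpha> x \<le> j then entry \<alpha> x else entry \<alpha> x + len \<beta>)"
  using i by (subst entry_balloon) (auto simp: balloon_entry_def)

lemma entry_balloon_blue:
  "x \<in> blue_points i \<beta> \<Longrightarrow> entry (balloon \<alpha> i j \<beta>) x = entry \<beta> (x - i) + j"
  using i by (subst entry_balloon) (auto simp: balloon_entry_def blue_points_def)

lemma entry_balloon_right:
  "x \<in> {i + 1..len \<alpha>} \<Longrightarrow> entry (balloon \<alpha> i j \<beta>) (x + len \<beta>) =
    (if entry \<alpha> x \<le> j then entry \<alpha> x else entry \<alpha> x + len \<beta>)"
  by (subst entry_balloon) (auto simp: balloon_entry_def)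

lemma entry_balloon_blue_range:
  "x \<in> blue_points i \<beta> \<Longrightarrow> entry (balloon \<alpha> i j \<beta>) x \<in> {j + 1..j + len \<beta>}"
proof -
  assume x: "x \<in> blue_points i \<beta>"
  then have "x - i \<in> {1..len \<beta>}" by (auto simp: blue_points_def)
  from entry_range[OF this] show ?thesis by (simp add: entry_balloon_blue[OF x])
qed

lemma blue_points_subset: "blue_points i \<beta> \<subseteq> {1..len (balloon \<alpha> i j \<beta>)}"
  using i by (auto simp: blue_points_def len_balloon)

lemma embedding_blue:
  assumes G: "embedding G \<eta> \<beta>"
  shows "embedding ((\<lambda>x. x + i) ` G) \<eta> (balloon \<alpha> i j \<beta>)"
proof -
  have sub: "G \<subseteq> {1..len \<beta>}" using G unfolding embedding_def by blast
  have "x + i \<in> blue_points i \<beta>" if "x \<in> G" for x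
    using that sub by (auto simp: blue_points_def)
  then have "pattern_map G (\<lambda>x. x + i) \<beta> (balloon \<alpha> i j \<beta>)"
    and "(\<lambda>x. x + i) ` G \<subseteq> blue_points i \<beta>"
    unfolding pattern_map_def monotone_on_def by (auto simp: entry_balloon_blue)
  then show ?thesis
    by (rule embedding_transport[OF G _ order.trans[OF _ blue_points_subset]])
qed

lemma embedding_blue_points: "embedding (blue_points i \<beta>) \<beta> (balloon \<alpha> i j \<beta>)"
proof -
  have "(\<lambda>x. x + i) ` {1..len \<beta>} = blue_points i \<beta>"
    by (simp add: blue_points_def add.commute)
  then show ?thesis using embedding_blue[OF embedding_full] by metis
qed

text \<open>The red points always form the same frame \<open>\<alpha>\<close>, and every blue point lies in the same gap of its
  columns and of its rows. So cutting the blue points down to a copy of \<open>\<zeta>\<close> leaves a copy of the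
  balloon around \<open>\<zeta>\<close>.\<close>

lemma embedding_red_union:
  assumes B: "embedding B \<zeta> (balloon \<alpha> i j \<beta>)" and sub: "B \<subseteq> blue_points i \<beta>"
  shows "embedding ({1..len (balloon \<alpha> i j \<beta>)} - blue_points i \<beta> \<union> B)
    (balloon \<alpha> i j \<zeta>) (balloon \<alpha> i j \<beta>)"
proof -
  let ?a = "len \<alpha>" and ?n = "len \<zeta>" and ?m = "len \<beta>"
  let ?\<pi> = "balloon \<alpha> i j \<beta>" and ?\<tau> = "balloon \<alpha> i j \<zeta>"
  obtain g where g_mono: "strict_mono_on {1..?n} g" and g_im: "g ` {1..?n} = B"
    and g_ord: "\<And>x y. x \<in> {1..?n} \<Longrightarrow> y \<in> {1..?n} \<Longrightarrow>
      entry \<zeta> x < entry \<zeta> y \<longleftrightarrow> entry ?\<pi> (g x) < entry ?\<pi> (g y)"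
    using B unfolding embedding_def by blast
  have g_blue: "g x \<in> blue_points i \<beta>" if "x \<in> {1..?n}" for x
    using that g_im sub by blast
  \<comment> \<open>\<open>g\<close> is applied to the blue points; the red points to their right are shifted by the
    difference of the two lengths\<close>
  define f where
    "f x = (if x \<le> i then x else if x \<le> i + ?n then g (x - i) else x - ?n + ?m)" for x
  define A where "A = {1..?a + ?n}"
  have A_cases: "x \<in> {1..i} \<or> x \<in> blue_points i \<zeta> \<or> (\<exists>y\<in>{i + 1..?a}. x = y + ?n)"
    if "x \<in> A" for x
  proof (cases "x \<le> i + ?n")
    case True
    then show ?thesis using that by (auto simp: A_def blue_points_def)
  next
    case False
    then have "x - ?n \<in> {i + 1..?a}" "x = x - ?n + ?n" using that by (auto simp: A_def)
    then show ?thesis by blast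
  qed
  have f_left: "f x = x" if "x \<in> {1..i}" for x
    using that by (simp add: f_def)
  have f_blue: "f x = g (x - i)" "x - i \<in> {1..?n}" "f x \<in> blue_points i \<beta>"
    if "x \<in> blue_points i \<zeta>" for x
  proof -
    show fx: "f x = g (x - i)" and xi: "x - i \<in> {1..?n}"
      using that by (auto simp: f_def blue_points_def)
    show "f x \<in> blue_points i \<beta>" unfolding fx by (rule g_blue[OF xi])
  qed
  have f_right: "f (y + ?n) = y + ?m" if "y \<in> {i + 1..?a}" for y
    using that by (simp add: f_def)
  have mono: "f x < f y" if "x \<in> A" "y \<in> A" "x < y" for x y
  proof -
    have "x - i < y - i" if "i < x" using that \<open>x < y\<close> by simp
    then show ?thesis
      using A_cases[OF that(1)] A_cases[OF that(2)] \<open>x < y\<close>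
        f_blue[of x] f_blue[of y] strict_mono_onD[OF g_mono, of "x - i" "y - i"]
      by (auto simp: f_left f_right blue_points_def)
  qed
  have entry_left: "entry ?\<tau> x = (if entry \<alpha> x \<le> j then entry \<alpha> x else entry \<alpha> x + ?n)"
    "entry ?\<pi> (f x) = (if entry \<alpha> x \<le> j then entry \<alpha> x else entry \<alpha> x + ?m)"
    if "x \<in> {1..i}" for x
    using that by (simp_all only: f_left entry_balloon_left)
  have entry_right: "entry ?\<tau> (x + ?n) = (if entry \<alpha> x \<le> j then entry \<alpha> x else entry \<alpha> x + ?n)"
    "entry ?\<pi> (f (x + ?n)) = (if entry \<alpha> x \<le> j then entry \<alpha> x else entry \<alpha> x + ?m)"
    if "x \<in> {i + 1..?a}" for x
    using that by (simp_all only: f_right entry_balloon_right)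
  \<comment> \<open>a red value is \<open>v\<close> or \<open>v\<close> shifted past the blue values, with the same \<open>v\<close> in both balloons,
    so its order relative to any other point is the same in both\<close>
  have red_cases: "x \<in> blue_points i \<zeta> \<or>
      (\<exists>v. entry ?\<tau> x = (if v \<le> j then v else v + ?n) \<and>
           entry ?\<pi> (f x) = (if v \<le> j then v else v + ?m))" if "x \<in> A" for x
    using A_cases[OF that] entry_left entry_right by metis
  have ord: "entry ?\<tau> x < entry ?\<tau> y \<longleftrightarrow> entry ?\<pi> (f x) < entry ?\<pi> (f y)"
    if "x \<in> A" "y \<in> A" for x y
  proof (cases "x \<in> blue_points i \<zeta> \<and> y \<in> blue_points i \<zeta>")
    case True
    then show ?thesis using f_blue g_ord by (simp add: entry_balloon_blue)
  next
    case False
    then show ?thesis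
      using red_cases[OF that(1)] red_cases[OF that(2)]
        entry_balloon_blue_range[of x \<zeta>] entry_balloon_blue_range[of y \<zeta>]
        entry_balloon_blue_range[OF f_blue(3), of x] entry_balloon_blue_range[OF f_blue(3), of y]
      by (elim disjE exE) (auto split: if_splits)
  qed
  have im: "f ` A = {1..len ?\<pi>} - blue_points i \<beta> \<union> B"
  proof (intro equalityI subsetI)
    fix z assume "z \<in> f ` A"
    then obtain x where x: "x \<in> A" "z = f x" by blast
    from A_cases[OF x(1)] show "z \<in> {1..len ?\<pi>} - blue_points i \<beta> \<union> B"
    proof (elim disjE bexE)
      assume "x \<in> blue_points i \<zeta>"
      then show ?thesis using f_blue g_im x by auto
    qed (use x i f_left f_right in \<open>auto simp: len_balloon blue_points_def\<close>)
  next
    fix z assume "z \<in> {1..len ?\<pi>} - blue_points i \<beta> \<union> B"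
    then consider "z \<in> {1..i}" | "z \<in> {i + ?m + 1..?a + ?m}" | "z \<in> B"
      by (fastforce simp: len_balloon blue_points_def)
    then show "z \<in> f ` A"
    proof cases
      case 1
      then show ?thesis
        using i by (intro image_eqI[of _ f z]) (auto simp: f_left A_def)
    next
      case 2
      then have "z - ?m \<in> {i + 1..?a}" by auto
      from f_right[OF this] show ?thesis
        using 2 by (intro image_eqI[of _ f "z - ?m + ?n"]) (auto simp: A_def)
    next
      case 3
      then obtain x where x: "x \<in> {1..?n}" "z = g x" using g_im by blast
      then have "f (x + i) = z" by (simp add: f_def)
      then show ?thesis
        using x i by (intro image_eqI[of _ f "x + i"]) (auto simp: A_def)
    qed
  qed
  have "pattern_map A f ?\<tau> ?\<pi>"
    unfolding pattern_map_def using mono ord by (auto intro: strict_mono_onI)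
  moreover have "{1..len ?\<tau>} = A" unfolding A_def len_balloon ..
  ultimately show ?thesis
    using im sub blue_points_subset[of \<beta>] unfolding embedding_iff_pattern_map by auto
qed

lemma balloon_mono:
  assumes "\<eta> \<le> \<beta>"
  shows "balloon \<alpha> i j \<eta> \<le> balloon \<alpha> i j \<beta>"
proof -
  obtain B where "B \<subseteq> blue_points i \<beta>" "embedding B \<eta> (balloon \<alpha> i j \<beta>)"
    using embedding_within_embedding[OF embedding_blue_points assms] by blast
  then show ?thesis
    using embedding_red_union unfolding less_eq_permutation_def by blast
qed

text \<open>An embedding cannot move a blue point out of the blue columns: in the smaller balloon it has at
  least \<open>i\<close> points to its left and at least \<open>len \<alpha> - i\<close> to its right, and only the blue columns
  leave that much room. So every embedding restricts to one of \<open>\<eta>\<close> in the blue copy of \<open>\<beta>\<close>.\<close>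

lemma balloon_le_cancel:
  assumes le: "balloon \<alpha> i j \<eta> \<le> balloon \<alpha> i j \<beta>"
  shows "\<eta> \<le> \<beta>"
proof -
  let ?\<tau> = "balloon \<alpha> i j \<eta>" and ?\<pi> = "balloon \<alpha> i j \<beta>"
  obtain f where f: "pattern_map {1..len ?\<tau>} f ?\<tau> ?\<pi>" and ran: "f ` {1..len ?\<tau>} \<subseteq> {1..len ?\<pi>}"
    using le unfolding less_eq_permutation_def embedding_iff_pattern_map by blast
  have mono: "strict_mono_on {1..len ?\<tau>} f" using f unfolding pattern_map_def by blast
  have "f x \<in> blue_points i \<beta>" if x: "x \<in> blue_points i \<eta>" for x
    using strict_mono_on_bounds[OF mono ran, of x] x i blue_points_subset[of \<eta>]
    by (auto simp: len_balloon blue_points_def)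
  then have blue: "f ` blue_points i \<eta> \<subseteq> blue_points i \<beta>" by blast
  have "embedding (f ` blue_points i \<eta>) \<eta> ?\<pi>"
    by (rule embedding_transport[OF embedding_blue_points pattern_map_subset[OF f blue_points_subset]
          order.trans[OF blue blue_points_subset]])
  then show ?thesis by (rule le_if_embedding_subset[OF _ embedding_blue_points blue])
qed

lemma card_blue_points: "card (blue_points i \<beta>) = len \<beta>"
  by (simp add: blue_points_def)

text \<open>Place the balloon around \<open>\<eta>\<close> in that around \<open>\<beta>\<close> so that colours are preserved, which is
  possible by cancellation. A copy of \<open>\<psi>\<close> inside it then has its blue points within a copy of
  \<open>\<eta>\<close>.\<close>

lemma complete_ge_blue_pattern:
  assumes le: "\<psi> \<le> balloon \<alpha> i j \<eta>" and "balloon \<alpha> i j \<eta> \<le> balloon \<alpha> i j \<beta>"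
  obtains \<zeta> where "\<zeta> \<in> blue_patterns \<alpha> i j \<beta> \<psi>" and "\<zeta> \<le> \<eta>"
proof -
  let ?\<pi> = "balloon \<alpha> i j \<beta>"
  have "\<eta> \<le> \<beta>" using assms(2) by (rule balloon_le_cancel)
  then obtain B where B: "B \<subseteq> blue_points i \<beta>" "embedding B \<eta> ?\<pi>"
    using embedding_within_embedding[OF embedding_blue_points] by blast
  obtain S where S: "S \<subseteq> {1..len ?\<pi>} - blue_points i \<beta> \<union> B" "embedding S \<psi> ?\<pi>"
    using embedding_within_embedding[OF embedding_red_union[OF B(2,1)] le] by blast
  obtain \<zeta> where \<zeta>: "embedding (S \<inter> blue_points i \<beta>) \<zeta> ?\<pi>"
    using pattern_exists[of "S \<inter> blue_points i \<beta>" ?\<pi>] blue_points_subset by blast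
  have "\<zeta> \<in> blue_patterns \<alpha> i j \<beta> \<psi>" unfolding blue_patterns_def using S(2) \<zeta> by blast
  moreover have "\<zeta> \<le> \<eta>" using le_if_embedding_subset[OF \<zeta> B(2)] S(1) by blast
  ultimately show ?thesis by (rule that)
qed

text \<open>The witness is the balloon around the least blue pattern \<open>\<zeta>\<close> of \<open>\<psi>\<close>. Adding all red points to
  an embedding of \<open>\<psi>\<close> with blue pattern \<open>\<zeta>\<close> shows that it lies above \<open>\<psi>\<close>; minimality of \<open>\<zeta>\<close>
  and \<open>complete_ge_blue_pattern\<close> put it below every other complete permutation between \<open>\<psi>\<close>
  and the balloon around \<open>\<beta>\<close>. It differs from the latter and is not a proper reduction
  because \<open>\<psi>\<close> itself is not a proper reduction: some embedding of \<open>\<psi>\<close> misses a blue point, which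
  forces \<open>len \<zeta> < len \<beta>\<close>.\<close>

lemma matryoshka_least_complete_above:
  assumes \<psi>: "matryoshka \<alpha> i j \<beta> \<psi>"
  obtains \<tau> where "complete_perm \<alpha> i j \<tau>" and "\<psi> < \<tau>" and "\<tau> < balloon \<alpha> i j \<beta>"
    and "\<tau> \<notin> proper_reductions \<alpha> i j \<beta>"
    and "\<And>\<rho>. complete_perm \<alpha> i j \<rho> \<Longrightarrow> \<psi> < \<rho> \<Longrightarrow> \<rho> \<le> balloon \<alpha> i j \<beta> \<Longrightarrow> \<tau> \<le> \<rho>"
proof -
  let ?\<pi> = "balloon \<alpha> i j \<beta>" and ?E = "blue_patterns \<alpha> i j \<beta> \<psi>"
  have nonempty: "\<psi> \<noteq> empty_perm" and le: "\<psi> \<le> ?\<pi>" and nc: "\<not> complete_perm \<alpha> i j \<psi>"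
    and nr: "\<psi> \<notin> proper_reductions \<alpha> i j \<beta>"
    using \<psi> unfolding matryoshka_def by auto
  obtain \<zeta> where \<zeta>E: "\<zeta> \<in> ?E" and min: "\<And>\<zeta>'. \<zeta>' \<in> ?E \<Longrightarrow> \<zeta> \<le> \<zeta>'"
    using \<psi> unfolding matryoshka_def by (metis order.refl less_imp_le)
  obtain S where S: "embedding S \<psi> ?\<pi>" and B: "embedding (S \<inter> blue_points i \<beta>) \<zeta> ?\<pi>"
    using \<zeta>E unfolding blue_patterns_def by blast
  define T where "T = {1..len ?\<pi>} - blue_points i \<beta> \<union> S \<inter> blue_points i \<beta>"
  have T: "embedding T (balloon \<alpha> i j \<zeta>) ?\<pi>"
    unfolding T_def using embedding_red_union[OF B] by blast
  have "S \<subseteq> T" unfolding T_def using S unfolding embedding_def by blast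
  have complete: "complete_perm \<alpha> i j (balloon \<alpha> i j \<eta>)" for \<eta>
    unfolding complete_perm_def by blast
  have "len \<zeta> < len \<beta>"
  proof -
    have "\<psi> \<noteq> ?\<pi>" using nc complete by blast
    then obtain S' where S': "embedding S' \<psi> ?\<pi>" "\<not> blue_points i \<beta> \<subseteq> S'"
      using nr nonempty le unfolding proper_reductions_def by blast
    obtain \<zeta>' where \<zeta>': "embedding (S' \<inter> blue_points i \<beta>) \<zeta>' ?\<pi>"
      using pattern_exists[of "S' \<inter> blue_points i \<beta>" ?\<pi>] blue_points_subset by blast
    have "\<zeta> \<le> \<zeta>'" using min S'(1) \<zeta>' unfolding blue_patterns_def by blast
    then have "len \<zeta> \<le> len \<zeta>'" by (rule permutation_le_len)
    also have "\<dots> = card (S' \<inter> blue_points i \<beta>)" using embedding_card[OF \<zeta>'] by simp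
    also have "\<dots> < card (blue_points i \<beta>)"
      using S'(2) by (intro psubset_card_mono) (auto simp: blue_points_def)
    finally show ?thesis by (simp add: card_blue_points)
  qed
  have "\<not> blue_points i \<beta> \<subseteq> S"
    using embedding_card[OF B] \<open>len \<zeta> < len \<beta>\<close> card_blue_points[of \<beta>]
    by (metis inf.absorb2 less_irrefl)
  show ?thesis
  proof (rule that)
    show "complete_perm \<alpha> i j (balloon \<alpha> i j \<zeta>)" by (rule complete)
    have "\<psi> \<le> balloon \<alpha> i j \<zeta>" by (rule le_if_embedding_subset[OF S T \<open>S \<subseteq> T\<close>])
    then show "\<psi> < balloon \<alpha> i j \<zeta>" using nc complete by (metis order.not_eq_order_implies_strict)
    have "balloon \<alpha> i j \<zeta> \<le> ?\<pi>" using T unfolding less_eq_permutation_def by blast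
    moreover have "balloon \<alpha> i j \<zeta> \<noteq> ?\<pi>"
      using \<open>len \<zeta> < len \<beta>\<close> len_balloon by (metis add_left_imp_eq less_irrefl)
    ultimately show "balloon \<alpha> i j \<zeta> < ?\<pi>" by simp
    show "balloon \<alpha> i j \<zeta> \<notin> proper_reductions \<alpha> i j \<beta>"
      using T \<open>\<not> blue_points i \<beta> \<subseteq> S\<close> unfolding proper_reductions_def T_def by blast
    fix \<rho> assume \<rho>: "complete_perm \<alpha> i j \<rho>" "\<psi> < \<rho>" "\<rho> \<le> ?\<pi>"
    then obtain \<eta> where \<eta>: "\<rho> = balloon \<alpha> i j \<eta>" unfolding complete_perm_def by blast
    obtain \<zeta>' where "\<zeta>' \<in> ?E" "\<zeta>' \<le> \<eta>"
      using complete_ge_blue_pattern[of \<psi> \<eta> \<beta>] \<rho>(2,3) unfolding \<eta> by (blast intro: less_imp_le)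
    then have "\<zeta> \<le> \<eta>" using min order.trans by blast
    then show "balloon \<alpha> i j \<zeta> \<le> \<rho>" unfolding \<eta> by (rule balloon_mono)
  qed
qed

lemma one_perm_not_complete: "len \<alpha> > 1 \<Longrightarrow> \<not> complete_perm \<alpha> i j one_perm"
  unfolding complete_perm_def using len_balloon len_one_perm by (metis add_leE leD le_refl)

end


section \<open>Signed sums over chains\<close>

lemma chain_elements_finite: "c \<in> chains_from_one \<pi> \<Longrightarrow> finite c"
  by (rule finite_subset[OF _ finite_atMost_permutation[of \<pi>]]) (auto simp: chains_from_one_def)

lemma finite_chains_from_one: "finite (chains_from_one \<pi>)"
proof -
  have "chains_from_one \<pi> \<subseteq> Pow {..\<pi>}" unfolding chains_from_one_def by auto
  then show ?thesis using finite_atMost_permutation finite_subset by blast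
qed

lemma chain_bounds:
  "c \<in> chains_from_one \<pi> \<Longrightarrow> x \<in> c \<Longrightarrow> one_perm \<le> x"
  "c \<in> chains_from_one \<pi> \<Longrightarrow> x \<in> c \<Longrightarrow> x \<le> \<pi>"
  unfolding chains_from_one_def by auto

lemma chain_total:
  "c \<in> chains_from_one \<pi> \<Longrightarrow> x \<in> c \<Longrightarrow> y \<in> c \<Longrightarrow> x \<le> y \<or> y \<le> x"
  unfolding chains_from_one_def Complete_Partial_Order.chain_def by blast

lemma chain_has_greatest:
  assumes c: "c \<in> chains_from_one \<pi>" and "x \<in> c" and "P x"
  shows "(GREATEST y. y \<in> c \<and> P y) \<in> c" and "P (GREATEST y. y \<in> c \<and> P y)"
    and "\<And>z. z \<in> c \<Longrightarrow> P z \<Longrightarrow> z \<le> (GREATEST y. y \<in> c \<and> P y)"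
proof -
  let ?A = "{y \<in> c. P y}"
  have "finite ?A" "?A \<noteq> {}" using chain_elements_finite[OF c] assms(2,3) by auto
  then obtain m where m: "m \<in> ?A" "\<forall>b\<in>?A. m \<le> b \<longrightarrow> m = b"
    using finite_has_maximal by blast
  then have max: "b \<le> m" if "b \<in> c" "P b" for b
    using chain_total[OF c, of m b] that by blast
  have eq: "(GREATEST y. y \<in> c \<and> P y) = m"
    by (rule Greatest_equality) (use m max in auto)
  show "(GREATEST y. y \<in> c \<and> P y) \<in> c" and "P (GREATEST y. y \<in> c \<and> P y)"
    and "\<And>z. z \<in> c \<Longrightarrow> P z \<Longrightarrow> z \<le> (GREATEST y. y \<in> c \<and> P y)"
    unfolding eq using m max by auto
qed

lemma second_highest_eq:
  assumes "c \<in> chains_from_one \<pi>"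
  shows "second_highest c = (GREATEST \<kappa>. \<kappa> \<in> c \<and> \<kappa> \<noteq> \<pi>)"
proof -
  have "(GREATEST \<tau>. \<tau> \<in> c) = \<pi>"
    by (rule Greatest_equality) (use assms in \<open>auto simp: chains_from_one_def\<close>)
  then show ?thesis unfolding second_highest_def by simp
qed

lemma second_highest_props:
  assumes c: "c \<in> chains_from_one \<pi>" and "\<pi> \<noteq> one_perm"
  shows "second_highest c \<in> c" and "second_highest c \<noteq> \<pi>"
    and "\<And>x. x \<in> c \<Longrightarrow> x \<noteq> \<pi> \<Longrightarrow> x \<le> second_highest c"
proof -
  have "one_perm \<in> c" using c unfolding chains_from_one_def by blast
  from chain_has_greatest[OF c this, of "\<lambda>x. x \<noteq> \<pi>"] assms(2)
  show "second_highest c \<in> c" and "second_highest c \<noteq> \<pi>"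
    and "\<And>x. x \<in> c \<Longrightarrow> x \<noteq> \<pi> \<Longrightarrow> x \<le> second_highest c"
    unfolding second_highest_eq[OF c] by auto
qed

text \<open>Every chain ending at \<open>\<rho>\<close> extends by \<open>\<pi>\<close>, and the extension has \<open>\<rho>\<close> second-highest.\<close>

lemma chains_with_second_highest:
  assumes \<rho>: "one_perm \<le> \<rho>" "\<rho> < \<pi>"
  shows "{c \<in> chains_from_one \<pi>. second_highest c = \<rho>} = insert \<pi> ` chains_from_one \<rho>"
proof (intro equalityI subsetI)
  have ne: "\<pi> \<noteq> one_perm" using \<rho> by auto
  fix c assume "c \<in> {c \<in> chains_from_one \<pi>. second_highest c = \<rho>}"
  then have c: "c \<in> chains_from_one \<pi>" and sh: "second_highest c = \<rho>" by auto
  have "c - {\<pi>} \<subseteq> {one_perm..\<rho>}"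
    using c second_highest_props(3)[OF c ne] unfolding sh chains_from_one_def by fastforce
  then have "c - {\<pi>} \<in> chains_from_one \<rho>"
    using c second_highest_props(1,2)[OF c ne] ne chain_subset[of "(\<le>)" c "c - {\<pi>}"]
    unfolding sh chains_from_one_def by auto
  moreover have "insert \<pi> (c - {\<pi>}) = c" using c unfolding chains_from_one_def by auto
  ultimately show "c \<in> insert \<pi> ` chains_from_one \<rho>" by (metis imageI)
next
  fix c assume "c \<in> insert \<pi> ` chains_from_one \<rho>"
  then obtain d where d: "d \<in> chains_from_one \<rho>" and c: "c = insert \<pi> d" by blast
  have below: "x \<le> \<rho>" if "x \<in> d" for x using d that unfolding chains_from_one_def by auto
  then have below': "x \<le> \<pi>" if "x \<in> d" for x using \<rho>(2) that by fastforce
  have ch: "c \<in> chains_from_one \<pi>"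
    using d below' unfolding c chains_from_one_def Complete_Partial_Order.chain_def by auto
  have "second_highest c = \<rho>"
    unfolding second_highest_eq[OF ch]
    by (rule Greatest_equality) (use c d \<rho>(2) below in \<open>auto simp: chains_from_one_def\<close>)
  with ch show "c \<in> {c \<in> chains_from_one \<pi>. second_highest c = \<rho>}" by blast
qed

definition signed_chain_sum :: "permutation set set \<Rightarrow> int" where
  "signed_chain_sum C = (\<Sum>c\<in>C. (-1) ^ chain_length c)"

text \<open>Group the chains by their second-highest element; adding the top flips the sign.\<close>

lemma signed_chain_sum_second_highest:
  assumes P: "P \<subseteq> {one_perm..<\<pi>}"
  shows "signed_chain_sum {c \<in> chains_from_one \<pi>. second_highest c \<in> P} =
    - (\<Sum>\<rho>\<in>P. signed_chain_sum (chains_from_one \<rho>))"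
proof -
  let ?s = "\<lambda>c. (-1) ^ chain_length c :: int"
  have "P \<subseteq> {..\<pi>}" using P by (auto dest!: subsetD)
  then have fin: "finite P" using finite_atMost_permutation finite_subset by blast
  have fiber: "(\<Sum>c | c \<in> chains_from_one \<pi> \<and> second_highest c = \<rho>. ?s c) =
      - signed_chain_sum (chains_from_one \<rho>)" if "\<rho> \<in> P" for \<rho>
  proof -
    have \<rho>: "one_perm \<le> \<rho>" "\<rho> < \<pi>" using P that by auto
    have notin: "\<pi> \<notin> d" if "d \<in> chains_from_one \<rho>" for d
      using \<rho>(2) chain_bounds(2)[OF that, of \<pi>] by (auto dest: leD)
    have inj: "inj_on (insert \<pi>) (chains_from_one \<rho>)"
      using notin by (metis inj_onI insert_ident)
    have sign: "?s (insert \<pi> d) = - ?s d" if d: "d \<in> chains_from_one \<rho>" for d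
    proof -
      have "card d \<noteq> 0"
        using chain_elements_finite[OF d] d unfolding chains_from_one_def by auto
      then obtain k where "card d = Suc k" using not0_implies_Suc by blast
      then show ?thesis
        using chain_elements_finite[OF d] notin[OF d] by (simp add: chain_length_def)
    qed
    have "(\<Sum>c | c \<in> chains_from_one \<pi> \<and> second_highest c = \<rho>. ?s c) =
        (\<Sum>d\<in>chains_from_one \<rho>. ?s (insert \<pi> d))"
      unfolding chains_with_second_highest[OF \<rho>] by (simp add: sum.reindex[OF inj])
    also have "\<dots> = - signed_chain_sum (chains_from_one \<rho>)"
      unfolding signed_chain_sum_def sum_negf[symmetric] by (rule sum.cong[OF refl sign])
    finally show ?thesis .
  qed
  have "signed_chain_sum {c \<in> chains_from_one \<pi>. second_highest c \<in> P} =
      (\<Sum>\<rho>\<in>P. \<Sum>c | c \<in> {c \<in> chains_from_one \<pi>. second_highest c \<in> P} \<and> second_highest c = \<rho>. ?s c)"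
    unfolding signed_chain_sum_def
    by (rule sum.group[symmetric]) (use fin finite_chains_from_one in auto)
  also have "\<dots> = (\<Sum>\<rho>\<in>P. \<Sum>c | c \<in> chains_from_one \<pi> \<and> second_highest c = \<rho>. ?s c)"
    by (intro sum.cong) auto
  also have "\<dots> = - (\<Sum>\<rho>\<in>P. signed_chain_sum (chains_from_one \<rho>))"
    unfolding sum_negf[symmetric] by (rule sum.cong[OF refl fiber])
  finally show ?thesis .
qed

text \<open>Hall's theorem for the lower bound \<open>one_perm\<close>: grouping all chains by their second-highest
  element turns the chain sum into the recursion that defines \<open>mobius\<close>.\<close>

lemma mobius_eq_signed_chain_sum:
  "one_perm \<le> \<pi> \<Longrightarrow> mobius one_perm \<pi> = signed_chain_sum (chains_from_one \<pi>)"
proof (induction "len \<pi>" arbitrary: \<pi> rule: less_induct)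
  case less
  show ?case
  proof (cases "\<pi> = one_perm")
    case True
    have "chains_from_one one_perm = {{one_perm}}"
      unfolding chains_from_one_def by (auto intro: chainI)
    then show ?thesis
      unfolding True by (simp add: mobius.simps signed_chain_sum_def chain_length_def)
  next
    case False
    then have lt: "one_perm < \<pi>" using less.prems by simp
    have "{c \<in> chains_from_one \<pi>. second_highest c \<in> {one_perm..<\<pi>}} = chains_from_one \<pi>"
    proof (intro equalityI subsetI)
      fix c assume c: "c \<in> chains_from_one \<pi>"
      then have "second_highest c \<in> {one_perm..<\<pi>}"
        using second_highest_props(1,2)[OF c False] chain_bounds[OF c, of "second_highest c"]
        by simp
      with c show "c \<in> {c \<in> chains_from_one \<pi>. second_highest c \<in> {one_perm..<\<pi>}}" by blast
    qed blast
    then have "signed_chain_sum (chains_from_one \<pi>) =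
        - (\<Sum>\<rho>\<in>{one_perm..<\<pi>}. signed_chain_sum (chains_from_one \<rho>))"
      using signed_chain_sum_second_highest[of "{one_perm..<\<pi>}" \<pi>] by simp
    also have "\<dots> = - (\<Sum>\<rho>\<in>{one_perm..<\<pi>}. mobius one_perm \<rho>)"
      using less.hyps permutation_less_len by simp
    also have "\<dots> = mobius one_perm \<pi>"
      using lt by (subst (2) mobius.simps) simp
    finally show ?thesis by simp
  qed
qed

text \<open>Toggling membership of \<open>t c\<close> changes the length by one, and it is an involution as soon as it
  does not affect the choice of \<open>t c\<close>. Nonemptiness matters because \<open>chain_length\<close> truncates the
  subtraction: the empty set and a singleton have the same length.\<close>

lemma signed_chain_sum_toggle_eq_0:
  fixes t :: "permutation set \<Rightarrow> permutation"
  defines "toggle \<equiv> \<lambda>c. if t c \<in> c then c - {t c} else insert (t c) c"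
  assumes closed: "\<And>c. c \<in> C \<Longrightarrow> toggle c \<in> C"
    and same: "\<And>c. c \<in> C \<Longrightarrow> t (toggle c) = t c"
    and fin: "\<And>c. c \<in> C \<Longrightarrow> finite c" and ne: "\<And>c. c \<in> C \<Longrightarrow> c \<noteq> {}"
  shows "signed_chain_sum C = 0"
proof -
  have invol: "toggle (toggle c) = c" if "c \<in> C" for c
    using same[OF that] unfolding toggle_def by (auto split: if_splits)
  have card: "card c > 0" if "c \<in> C" for c
    using fin ne that by (simp add: card_gt_0_iff)
  have sign: "- ((-1) ^ chain_length (toggle c)) = ((-1) ^ chain_length c :: int)"
    if c: "c \<in> C" for c
  proof (cases "t c \<in> c")
    case True
    then have "toggle c = c - {t c}" unfolding toggle_def by simp
    then have "card c = Suc (card (toggle c))"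
      using True fin[OF c] by (metis card_Suc_Diff1)
    moreover obtain k where "card (toggle c) = Suc k"
      using card[OF closed[OF c]] gr0_implies_Suc by blast
    ultimately show ?thesis by (simp add: chain_length_def)
  next
    case False
    then have "toggle c = insert (t c) c" unfolding toggle_def by simp
    then have "card (toggle c) = Suc (card c)" using False fin[OF c] by simp
    moreover obtain k where "card c = Suc k" using card[OF c] gr0_implies_Suc by blast
    ultimately show ?thesis by (simp add: chain_length_def)
  qed
  have "signed_chain_sum C = (\<Sum>c\<in>C. - ((-1) ^ chain_length c))"
    unfolding signed_chain_sum_def
    by (rule sum.reindex_bij_witness[where i = toggle and j = toggle])
      (use invol closed sign in auto)
  then show ?thesis unfolding signed_chain_sum_def by (simp add: sum_negf)
qed


section \<open>Matryoshka chains cancel\<close>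

text \<open>Toggle the least complete permutation above the pivot. Only a complete element enters or leaves
  the chain, so the pivot is unchanged; what needs care is that the second-highest element does not
  become a proper reduction.\<close>

lemma signed_chain_sum_M_chains:
  assumes \<alpha>: "len \<alpha> > 1" and i: "i \<le> len \<alpha>" and j: "j \<le> len \<alpha>"
  shows "signed_chain_sum (M_chains \<alpha> i j \<beta>) = 0"
proof -
  let ?\<pi> = "balloon \<alpha> i j \<beta>"
  let ?K = "complete_perm \<alpha> i j" and ?R = "proper_reductions \<alpha> i j \<beta>"
  have "\<exists>\<tau>. matryoshka \<alpha> i j \<beta> \<psi> \<longrightarrow> ?K \<tau> \<and> \<psi> < \<tau> \<and> \<tau> < ?\<pi> \<and> \<tau> \<notin> ?R \<and>
      (\<forall>\<rho>. ?K \<rho> \<longrightarrow> \<psi> < \<rho> \<longrightarrow> \<rho> \<le> ?\<pi> \<longrightarrow> \<tau> \<le> \<rho>)" for \<psi>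
    using matryoshka_least_complete_above[OF i j, of \<beta> \<psi>] by metis
  then obtain up where "\<forall>\<psi>. matryoshka \<alpha> i j \<beta> \<psi> \<longrightarrow>
      ?K (up \<psi>) \<and> \<psi> < up \<psi> \<and> up \<psi> < ?\<pi> \<and> up \<psi> \<notin> ?R \<and>
      (\<forall>\<rho>. ?K \<rho> \<longrightarrow> \<psi> < \<rho> \<longrightarrow> \<rho> \<le> ?\<pi> \<longrightarrow> up \<psi> \<le> \<rho>)"
    by metis
  then have up: "matryoshka \<alpha> i j \<beta> \<psi> \<Longrightarrow> ?K (up \<psi>)"
    "matryoshka \<alpha> i j \<beta> \<psi> \<Longrightarrow> \<psi> < up \<psi>"
    "matryoshka \<alpha> i j \<beta> \<psi> \<Longrightarrow> up \<psi> < ?\<pi>"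
    "matryoshka \<alpha> i j \<beta> \<psi> \<Longrightarrow> up \<psi> \<notin> ?R"
    "matryoshka \<alpha> i j \<beta> \<psi> \<Longrightarrow> ?K \<rho> \<Longrightarrow> \<psi> < \<rho> \<Longrightarrow> \<rho> \<le> ?\<pi> \<Longrightarrow> up \<psi> \<le> \<rho>" for \<psi> \<rho>
    by blast+
  define t where "t c = up (pivot \<alpha> i j c)" for c
  define toggle where "toggle c = (if t c \<in> c then c - {t c} else insert (t c) c)" for c
  have K_pi: "?K ?\<pi>" unfolding complete_perm_def by blast
  have not_K_one: "\<not> ?K one_perm" by (rule one_perm_not_complete[OF i j \<alpha>])
  have pi_ne: "?\<pi> \<noteq> one_perm" using K_pi not_K_one by metis
  have main: "toggle c \<in> M_chains \<alpha> i j \<beta> \<and> t (toggle c) = t c"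
    if cM: "c \<in> M_chains \<alpha> i j \<beta>" for c
  proof -
    define \<psi> where "\<psi> = pivot \<alpha> i j c"
    have c: "c \<in> chains_from_one ?\<pi>" and cR: "second_highest c \<notin> ?R"
      and mat: "matryoshka \<alpha> i j \<beta> \<psi>"
      using cM unfolding M_chains_def R_chains_def \<psi>_def by auto
    have c_sub: "c \<subseteq> {one_perm..?\<pi>}" and one_c: "one_perm \<in> c"
      using c unfolding chains_from_one_def by auto
    note \<psi> = chain_has_greatest[OF c one_c, of "\<lambda>x. \<not> ?K x", folded pivot_def,
        OF not_K_one, folded \<psi>_def]
    have tc: "t c = up \<psi>" unfolding t_def \<psi>_def ..
    note u = up[OF mat, folded tc]
    have cmp: "x \<le> t c \<or> t c \<le> x" if x: "x \<in> c" for x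
    proof (cases "x \<le> \<psi>")
      case True
      then show ?thesis using u(2) by fastforce
    next
      case False
      then have "\<psi> < x" "?K x" using chain_total[OF c x \<psi>(1)] \<psi>(3)[OF x] by auto
      then show ?thesis using u(5) x c_sub by auto
    qed
    have toggle_chain: "toggle c \<in> chains_from_one ?\<pi>"
    proof (cases "t c \<in> c")
      case True
      have "t c \<noteq> one_perm" "t c \<noteq> ?\<pi>" using u(1,3) not_K_one by auto
      then show ?thesis
        using True c chain_subset[of "(\<le>)" c "c - {t c}"]
        unfolding toggle_def chains_from_one_def by auto
    next
      case False
      have "one_perm \<le> t c" using \<psi>(1) c_sub u(2) by fastforce
      moreover have "Complete_Partial_Order.chain (\<le>) (insert (t c) c)"
        using chain_total[OF c] cmp by (intro chainI) auto
      ultimately show ?thesis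
        using False c u(3) unfolding toggle_def chains_from_one_def by auto
    qed
    have same_pivot: "pivot \<alpha> i j (toggle c) = \<psi>"
    proof -
      have "(x \<in> toggle c \<and> \<not> ?K x) = (x \<in> c \<and> \<not> ?K x)" for x
        using u(1) unfolding toggle_def by auto
      then show ?thesis unfolding \<psi>_def pivot_def by simp
    qed
    have "second_highest (toggle c) \<notin> ?R"
    proof
      let ?\<kappa>' = "second_highest (toggle c)" and ?\<kappa> = "second_highest c"
      assume R: "?\<kappa>' \<in> ?R"
      note \<kappa>' = second_highest_props[OF toggle_chain pi_ne]
      note \<kappa> = second_highest_props[OF c pi_ne]
      have mem: "x \<in> toggle c \<longleftrightarrow> x \<in> c" if "x \<noteq> t c" for x
        using that unfolding toggle_def by auto
      \<comment> \<open>the second-highest elements differ, so \<open>t c\<close> was second-highest and has been deleted; its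
        successor in that role lies strictly between \<open>\<psi>\<close> and \<open>t c\<close>, but there the chain has only
        complete elements and \<open>t c\<close> is the least complete one above \<open>\<psi>\<close>\<close>
      have "?\<kappa>' \<noteq> t c" using R u(4) by metis
      then have "?\<kappa>' \<le> ?\<kappa>" using mem \<kappa>'(1,2) \<kappa>(3) by blast
      have "?\<kappa>' \<noteq> ?\<kappa>" using R cR by metis
      then have "?\<kappa> = t c" using mem \<kappa>(1,2) \<kappa>'(3) \<open>?\<kappa>' \<le> ?\<kappa>\<close> by (meson order.antisym)
      then have "?\<kappa>' < t c" using \<open>?\<kappa>' \<le> ?\<kappa>\<close> \<open>?\<kappa>' \<noteq> ?\<kappa>\<close> by simp
      have "\<psi> \<in> toggle c" "\<psi> \<noteq> ?\<pi>" using mem u(2,3) \<psi>(1) by auto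
      then have "\<psi> \<le> ?\<kappa>'" by (rule \<kappa>'(3))
      have "\<psi> \<notin> ?R" using mat unfolding matryoshka_def by blast
      then have "\<psi> < ?\<kappa>'" using \<open>\<psi> \<le> ?\<kappa>'\<close> R by (metis order.not_eq_order_implies_strict)
      moreover have "?\<kappa>' \<in> c" using mem \<kappa>'(1) \<open>?\<kappa>' \<noteq> t c\<close> by blast
      ultimately have "?K ?\<kappa>'" using \<psi>(3)[of ?\<kappa>'] by (metis less_le_not_le)
      then have "t c \<le> ?\<kappa>'" using u(5) \<open>\<psi> < ?\<kappa>'\<close> \<open>?\<kappa>' \<in> c\<close> c_sub by auto
      then show False using \<open>?\<kappa>' < t c\<close> by simp
    qed
    then show ?thesis
      using toggle_chain same_pivot mat tc
      unfolding M_chains_def R_chains_def t_def by simp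
  qed
  have chains: "c \<in> chains_from_one ?\<pi>" if "c \<in> M_chains \<alpha> i j \<beta>" for c
    using that unfolding M_chains_def by blast
  show ?thesis
  proof (rule signed_chain_sum_toggle_eq_0[of _ t, folded toggle_def])
    show "finite c" if "c \<in> M_chains \<alpha> i j \<beta>" for c
      using chain_elements_finite[OF chains[OF that]] .
    show "c \<noteq> {}" if "c \<in> M_chains \<alpha> i j \<beta>" for c
      using chains[OF that] unfolding chains_from_one_def by blast
  qed (use main in blast)+
qed

theorem theorem69:
  fixes \<alpha> \<beta> \<pi> :: permutation and i j :: nat
  assumes "len \<alpha> > 1" and "len \<beta> \<ge> 1" and "i \<le> len \<alpha>" and "j \<le> len \<alpha>"
    and "\<pi> = balloon \<alpha> i j \<beta>"
  shows "mobius one_perm \<pi> =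
    - (\<Sum>\<rho>\<in>proper_reductions \<alpha> i j \<beta>. mobius one_perm \<rho>)
    + (\<Sum>c\<in>G_chains \<alpha> i j \<beta>. (-1) ^ chain_length c)"
proof -
  let ?C = "chains_from_one \<pi>" and ?P = "proper_reductions \<alpha> i j \<beta>"
  let ?R = "R_chains \<alpha> i j \<beta>" and ?M = "M_chains \<alpha> i j \<beta>" and ?G = "G_chains \<alpha> i j \<beta>"
  have "len \<pi> \<noteq> 0" using assms(1,3-5) len_balloon by simp
  then have "\<pi> \<noteq> empty_perm" by (auto simp: len_def one_line_empty_perm)
  have split: "?C = ?R \<union> (?M \<union> ?G)" "?R \<inter> (?M \<union> ?G) = {}" "?M \<inter> ?G = {}"
    unfolding R_chains_def M_chains_def G_chains_def assms(5) by auto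
  have P: "?P \<subseteq> {one_perm..<\<pi>}"
    unfolding proper_reductions_def assms(5) using one_perm_le by (auto simp: less_permutation_def)
  have "mobius one_perm \<pi> = signed_chain_sum ?C"
    by (rule mobius_eq_signed_chain_sum[OF one_perm_le[OF \<open>\<pi> \<noteq> empty_perm\<close>]])
  also have "\<dots> = signed_chain_sum ?R + signed_chain_sum ?M + signed_chain_sum ?G"
  proof -
    have "finite (?R \<union> (?M \<union> ?G))" using finite_chains_from_one[of \<pi>] unfolding split(1) .
    then show ?thesis
      unfolding split(1) signed_chain_sum_def
      using split(2,3) by (simp add: sum.union_disjoint)
  qed
  also have "signed_chain_sum ?M = 0" by (rule signed_chain_sum_M_chains[OF assms(1,3,4)])
  also have "signed_chain_sum ?R = - (\<Sum>\<rho>\<in>?P. signed_chain_sum (chains_from_one \<rho>))"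
    using signed_chain_sum_second_highest[OF P] unfolding R_chains_def assms(5) .
  also have "(\<Sum>\<rho>\<in>?P. signed_chain_sum (chains_from_one \<rho>)) = (\<Sum>\<rho>\<in>?P. mobius one_perm \<rho>)"
    by (rule sum.cong[OF refl]) (use P mobius_eq_signed_chain_sum in auto)
  finally show ?thesis unfolding signed_chain_sum_def by simp
qed

end
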